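(* There is a compact ultrametric space $X$ such that $X$ is countable (in particular its Hausdorff dimension is $0$) but $\operatorname{crit}_{\mathscr{P}}\mathscr{W}_p(X)=+\infty$ for all $p\in[1,+\infty)$.
   Context: An ultrametric space is a metric space $(X,d)$ with $d(x,z)\le\max(d(x,y),d(y,z))$ for all $x,y,z\in X$. For a compact metric space $X$ and $p\in[1,+\infty)$, $\mathscr{W}_p(X)=(\mathcal{P}(X),\mathrm{W}_p)$ is the set of Borel probability measures on $X$ endowed with the distance $$\mathrm{W}_p(\mu,\nu)=\left(\inf_{\Pi\in\Gamma(\mu,\nu)}\int_{X\times X}d(a,b)^p\,\Pi(\mathrm{d}a\,\mathrm{d}b)\right)^{1/p},$$ where $\Gamma(\mu,\nu)$ is the set of Borel probability measures on $X\times X$ with marginals $\mu$ and $\nu$. The power-exponential critical parameter $\operatorname{crit}_{\mathscr{P}}Z\in[0,+\infty]$ of a metric space $Z$ is defined as the Hausdorff dimension, with $\varepsilon^s$ replaced by $\exp(-\varepsilon^{-s})$: for $s>0$ put $f_s(r)=\exp(-1/r^s)$ for $r>0$ and $f_s(0)=0$, and $$\mathcal{H}^{s}(Z)=\lim_{\delta\to0}\ \inf\Big\{\sum_i f_s(\operatorname{diam}E_i)\ :\ (E_i)\text{ a countable cover of }Z\text{ with }\operatorname{diam}E_i\le\delta\ \forall i\Big\}.$$ Then $\operatorname{crit}_{\mathscr{P}}Z=\sup\{s>0:\mathcal{H}^s(Z)>0\}$, with $\sup\emptyset=0$. *)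

theory Defs
  imports "HOL-Probability.Probability"
begin

text \<open>
  Spaces are given by a carrier and a distance function, as in the library locale
  \<^locale>\<open>Metric_space\<close>.
\<close>

locale Ultrametric_space = Metric_space +
  assumes ultrametric:
    "\<lbrakk>x \<in> M; y \<in> M; z \<in> M\<rbrakk> \<Longrightarrow> d x z \<le> max (d x y) (d y z)"


subsection \<open>Hausdorff-type measures and critical parameters\<close>

definition ediam :: "('a \<Rightarrow> 'a \<Rightarrow> real) \<Rightarrow> 'a set \<Rightarrow> ennreal" where
  "ediam d E = (SUP (x, y)\<in>E \<times> E. ennreal (d x y))"

text \<open>
  Finite covers are included, since the gauges used below vanish at \<open>0\<close> and a finite
  cover can therefore be padded by empty sets, whose diameter is \<open>0\<close>.
\<close>

definition delta_covers ::
    "'a set \<Rightarrow> ('a \<Rightarrow> 'a \<Rightarrow> real) \<Rightarrow> real \<Rightarrow> (nat \<Rightarrow> 'a set) set" where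
  "delta_covers Z d \<delta> =
     {E. (\<forall>i. E i \<subseteq> Z \<and> ediam d (E i) \<le> ennreal \<delta>) \<and> Z \<subseteq> (\<Union>i. E i)}"

definition gauge_premeasure ::
    "(real \<Rightarrow> real) \<Rightarrow> 'a set \<Rightarrow> ('a \<Rightarrow> 'a \<Rightarrow> real) \<Rightarrow> real \<Rightarrow> ennreal" where
  "gauge_premeasure f Z d \<delta> =
     (INF E\<in>delta_covers Z d \<delta>. \<Sum>i. ennreal (f (enn2real (ediam d (E i)))))"

definition gauge_measure ::
    "(real \<Rightarrow> real) \<Rightarrow> 'a set \<Rightarrow> ('a \<Rightarrow> 'a \<Rightarrow> real) \<Rightarrow> ennreal" where
  "gauge_measure f Z d = Lim (at_right 0) (gauge_premeasure f Z d)"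

text \<open>The limit exists because the premeasure is monotone in \<open>\<delta>\<close>.\<close>

lemma gauge_premeasure_antimono:
  assumes "\<delta> \<le> \<delta>'"
  shows "gauge_premeasure f Z d \<delta>' \<le> gauge_premeasure f Z d \<delta>"
proof -
  have "delta_covers Z d \<delta> \<subseteq> delta_covers Z d \<delta>'"
    using ennreal_leI[OF assms] by (auto simp: delta_covers_def intro: order_trans)
  then show ?thesis
    unfolding gauge_premeasure_def by (intro INF_superset_mono) auto
qed

lemma tendsto_gauge_premeasure:
  "(gauge_premeasure f Z d \<longlongrightarrow> (SUP \<delta>\<in>{0<..}. gauge_premeasure f Z d \<delta>)) (at_right 0)"
proof (rule order_tendstoI)
  fix a assume "a < (SUP \<delta>\<in>{0<..}. gauge_premeasure f Z d \<delta>)"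
  then obtain \<delta>0 where *: "\<delta>0 > 0" "a < gauge_premeasure f Z d \<delta>0"
    by (auto simp: less_SUP_iff)
  have "a < gauge_premeasure f Z d \<delta>" if "\<delta> < \<delta>0" for \<delta>
    using *(2) gauge_premeasure_antimono[of \<delta> \<delta>0 f Z d] that by auto
  then show "\<forall>\<^sub>F \<delta> in at_right 0. a < gauge_premeasure f Z d \<delta>"
    using *(1) by (auto simp: eventually_at_right_field)
next
  fix a assume *: "(SUP \<delta>\<in>{0<..}. gauge_premeasure f Z d \<delta>) < a"
  have "gauge_premeasure f Z d \<delta> < a" if "\<delta> > 0" for \<delta>
    using that by (intro le_less_trans[OF SUP_upper *]) auto
  then show "\<forall>\<^sub>F \<delta> in at_right 0. gauge_premeasure f Z d \<delta> < a"
    by (auto simp: eventually_at_right_field intro: exI[of _ 1])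
qed

lemma gauge_measure_eq_SUP:
  "gauge_measure f Z d = (SUP \<delta>\<in>{0<..}. gauge_premeasure f Z d \<delta>)"
  unfolding gauge_measure_def by (rule tendsto_Lim[OF _ tendsto_gauge_premeasure]) simp

text \<open>In \<^typ>\<open>ennreal\<close> the supremum of the empty set is \<open>0\<close>.\<close>

definition critical_parameter ::
    "(real \<Rightarrow> real \<Rightarrow> real) \<Rightarrow> 'a set \<Rightarrow> ('a \<Rightarrow> 'a \<Rightarrow> real) \<Rightarrow> ennreal" where
  "critical_parameter F Z d = Sup {ennreal s | s. s > 0 \<and> gauge_measure (F s) Z d > 0}"

definition hausdorff_dim :: "'a set \<Rightarrow> ('a \<Rightarrow> 'a \<Rightarrow> real) \<Rightarrow> ennreal" where
  "hausdorff_dim = critical_parameter (\<lambda>s r. r powr s)"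

definition pow_exp_gauge :: "real \<Rightarrow> real \<Rightarrow> real" where
  "pow_exp_gauge s r = (if r > 0 then exp (- (1 / r powr s)) else 0)"

definition crit_P :: "'a set \<Rightarrow> ('a \<Rightarrow> 'a \<Rightarrow> real) \<Rightarrow> ennreal" where
  "crit_P = critical_parameter pow_exp_gauge"


subsection \<open>Wasserstein spaces\<close>

definition borel_of :: "'a topology \<Rightarrow> 'a measure" where
  "borel_of T = sigma (topspace T) {U. openin T U}"

definition borel_probs :: "'a topology \<Rightarrow> 'a measure set" where
  "borel_probs T = {\<mu>. sets \<mu> = sets (borel_of T) \<and> prob_space \<mu>}"

definition couplings ::
    "'a topology \<Rightarrow> 'a measure \<Rightarrow> 'a measure \<Rightarrow> ('a \<times> 'a) measure set" where
  "couplings T \<mu> \<nu> =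
     {P \<in> borel_probs (prod_topology T T).
        distr P (borel_of T) fst = \<mu> \<and> distr P (borel_of T) snd = \<nu>}"

text \<open>
  On a compact space the infimum is finite, so the conversion to \<^typ>\<open>real\<close> loses nothing.
\<close>

definition wasserstein_dist ::
    "'a set \<Rightarrow> ('a \<Rightarrow> 'a \<Rightarrow> real) \<Rightarrow> real \<Rightarrow> 'a measure \<Rightarrow> 'a measure \<Rightarrow> real" where
  "wasserstein_dist X d p \<mu> \<nu> =
     enn2real (INF P\<in>couplings (Metric_space.mtopology X d) \<mu> \<nu>.
       \<integral>\<^sup>+ (a, b). ennreal (d a b powr p) \<partial>P) powr (1 / p)"

end

theory Submission imports Defs begin

text \<open>
  Let \<open>X\<close> consist of \<open>0\<close> and, for each \<open>k\<close>, a block of \<open>N\<^sub>k\<close> points of size about \<open>1 / (k + 1)\<close>,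
  two distinct points being at distance the larger of the two. A sequence \<open>\<omega>\<close> selecting one point
  of each block gives the measure that puts mass \<open>2\<^sup>-\<^sup>k\<^sup>-\<^sup>1\<close> on the selected point of block \<open>k\<close>. If two
  selections differ at \<open>k\<close>, the whole mass of that point has to leave it, so the two measures are
  at distance at least \<open>4\<^sup>-\<^sup>k\<^sup>-\<^sup>1\<close>. Hence all selections landing in a set of smaller diameter agree at
  \<open>k\<close>, which for a uniform random selection has probability \<open>1 / N\<^sub>k\<close>. Compactness of \<open>X\<close> only needs
  the blocks to be finite, so \<open>N\<^sub>k\<close> can be taken so large that the mass distribution principle
  applies to every gauge \<open>exp (- r\<^sup>-\<^sup>s)\<close>.
\<close>

section \<open>Borel sigma-algebras of topologies\<close>

lemma space_borel_of [simp]: "space (borel_of T) = topspace T"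
  by (auto simp: borel_of_def dest: openin_subset intro!: space_measure_of)

lemma openin_sets_borel_of: "openin T U \<Longrightarrow> U \<in> sets (borel_of T)"
  unfolding borel_of_def by (subst sets_measure_of) (auto dest: openin_subset)

lemma closedin_sets_borel_of:
  assumes "closedin T C" shows "C \<in> sets (borel_of T)"
proof -
  have "space (borel_of T) - (topspace T - C) \<in> sets (borel_of T)"
    using assms by (intro sets.compl_sets openin_sets_borel_of) (auto simp: closedin_def)
  with closedin_subset[OF assms] show ?thesis
    by (simp add: double_diff)
qed

lemma continuous_map_measurable_borel_of:
  assumes "continuous_map S T f" shows "f \<in> borel_of S \<rightarrow>\<^sub>M borel_of T"
  unfolding borel_of_def[of T]
proof (rule measurable_measure_of)
  show "f -` U \<inter> space (borel_of S) \<in> sets (borel_of S)" if "U \<in> {U. openin T U}" for U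
  proof -
    have "f -` U \<inter> space (borel_of S) = {x \<in> topspace S. f x \<in> U}" by auto
    with openin_continuous_map_preimage[OF assms] that show ?thesis
      by (simp add: openin_sets_borel_of)
  qed
qed (use assms in \<open>auto simp: continuous_map_def dest: openin_subset\<close>)

section \<open>Geometric mixtures, their couplings, and a lower bound for the Wasserstein
  distance\<close>

text \<open>Mass \<open>(1/2) ^ Suc k\<close> sits at \<open>u k\<close>. Writing this as an image
  of a law on the naturals makes measurability automatic, and two such measures are coupled by
  drawing the same index for both.\<close>

definition geometric_mixture :: "'a topology \<Rightarrow> (nat \<Rightarrow> 'a) \<Rightarrow> 'a measure" where
  "geometric_mixture T u = distr (measure_pmf (geometric_pmf (1/2))) (borel_of T) u"

lemma geometric_mixture_in_borel_probs:
  assumes "range u \<subseteq> topspace T"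
  shows "geometric_mixture T u \<in> borel_probs T"
  using assms unfolding borel_probs_def geometric_mixture_def
  by (auto simp: range_subsetD intro!: measure_pmf.prob_space_distr)

lemma emeasure_geometric_mixture:
  assumes "range u \<subseteq> topspace T" "A \<in> sets (borel_of T)"
  shows "emeasure (geometric_mixture T u) A
    = emeasure (measure_pmf (geometric_pmf (1/2))) (u -` A)"
  using assms unfolding geometric_mixture_def by (subst emeasure_distr) auto

text \<open>Both marginals come from composing the projections with the sequence of pairs. This
  supplies the explicit coupling that is needed to show that the transport cost is finite.\<close>

lemma geometric_mixture_coupling:
  assumes "range u \<subseteq> topspace T" "range v \<subseteq> topspace T"
  shows "geometric_mixture (prod_topology T T) (\<lambda>k. (u k, v k))
    \<in> couplings T (geometric_mixture T u) (geometric_mixture T v)"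
proof -
  have *: "(\<lambda>k. (u k, v k)) \<in> measure_pmf (geometric_pmf (1/2)) \<rightarrow>\<^sub>M borel_of (prod_topology T T)"
    using assms by auto
  have "geometric_mixture (prod_topology T T) (\<lambda>k. (u k, v k)) \<in> borel_probs (prod_topology T T)"
    using assms by (intro geometric_mixture_in_borel_probs) auto
  moreover note
    distr_distr[OF continuous_map_measurable_borel_of[OF continuous_map_fst] *]
    distr_distr[OF continuous_map_measurable_borel_of[OF continuous_map_snd] *]
  ultimately show ?thesis
    unfolding couplings_def geometric_mixture_def by (simp add: comp_def)
qed

text \<open>
  The hypothesis on \<open>Q\<close> rules out an infinite infimum, which \<^const>\<open>enn2real\<close> would send to \<open>0\<close>.
\<close>

lemma (in Metric_space) wasserstein_dist_ge:
  assumes Q: "Q \<in> couplings mtopology \<mu> \<nu>" "(\<integral>\<^sup>+ (a, b). ennreal (d a b powr p) \<partial>Q) < \<infinity>"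
    and x: "x \<in> M" "emeasure \<nu> {x} = 0"
    and c: "0 \<le> c" "\<And>y. y \<in> M \<Longrightarrow> y \<noteq> x \<Longrightarrow> c \<le> d x y"
    and m: "0 \<le> m" "ennreal m \<le> emeasure \<mu> {x}"
    and p: "0 < p"
  shows "c * m powr (1 / p) \<le> wasserstein_dist M d p \<mu> \<nu>"
proof -
  let ?I = "INF P\<in>couplings mtopology \<mu> \<nu>. \<integral>\<^sup>+ (a, b). ennreal (d a b powr p) \<partial>P"
  have le: "ennreal (c powr p * m) \<le> (\<integral>\<^sup>+ (a, b). ennreal (d a b powr p) \<partial>P)"
    if P: "P \<in> couplings mtopology \<mu> \<nu>" for P
  proof -
    have setsP: "sets P = sets (borel_of (prod_topology mtopology mtopology))"
      and \<mu>: "distr P (borel_of mtopology) fst = \<mu>" and \<nu>: "distr P (borel_of mtopology) snd = \<nu>"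
      using P by (auto simp: couplings_def borel_probs_def)
    have spaceP: "space P = M \<times> M"
      using sets_eq_imp_space_eq[OF setsP] by simp
    have [measurable]: "fst \<in> P \<rightarrow>\<^sub>M borel_of mtopology" "snd \<in> P \<rightarrow>\<^sub>M borel_of mtopology"
      using continuous_map_measurable_borel_of[OF continuous_map_fst]
        continuous_map_measurable_borel_of[OF continuous_map_snd]
      by (simp_all add: measurable_cong_sets[OF setsP refl])
    have [measurable]: "{x} \<in> sets (borel_of mtopology)"
      using x by (intro closedin_sets_borel_of closedin_Hausdorff_singleton) (auto simp: Hausdorff_space_mtopology)
    \<comment> \<open>Mass leaving \<open>x\<close> lies in \<open>A\<close>; mass arriving at
      \<open>x\<close> lies in \<open>B\<close>, which is a null set because \<open>\<nu>\<close>
      does not charge \<open>x\<close>. On \<open>A - B\<close> the pair is \<open>(x, b)\<close>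
      with \<open>b\<close> different from \<open>x\<close>, so the cost there is at least
      \<open>c powr p\<close>.\<close>
    define A where "A = fst -` {x} \<inter> space P"
    define B where "B = snd -` {x} \<inter> space P"
    have [measurable]: "A \<in> sets P" "B \<in> sets P"
      unfolding A_def B_def by measurable
    have "ennreal m \<le> emeasure P A"
      using m unfolding A_def \<mu>[symmetric] by (simp add: emeasure_distr)
    also have "\<dots> \<le> emeasure P ((A - B) \<union> B)"
      by (intro emeasure_mono) auto
    also have "\<dots> \<le> emeasure P (A - B) + emeasure P B"
      by (intro emeasure_subadditive) auto
    also have "emeasure P B = 0"
      using x unfolding B_def \<nu>[symmetric] by (simp add: emeasure_distr)
    finally have "ennreal m \<le> emeasure P (A - B)" by simp
    then have "ennreal (c powr p * m) \<le> ennreal (c powr p) * emeasure P (A - B)"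
      using m by (simp add: ennreal_mult mult_left_mono)
    also have "\<dots> = (\<integral>\<^sup>+ z. ennreal (c powr p) * indicator (A - B) z \<partial>P)"
      by (simp add: nn_integral_cmult_indicator)
    also have "\<dots> \<le> (\<integral>\<^sup>+ (a, b). ennreal (d a b powr p) \<partial>P)"
    proof (rule nn_integral_mono)
      fix z assume "z \<in> space P"
      then show "ennreal (c powr p) * indicator (A - B) z
          \<le> (case z of (a, b) \<Rightarrow> ennreal (d a b powr p))"
        using c p by (cases z)
          (auto simp: A_def B_def spaceP indicator_def intro!: ennreal_leI powr_mono2)
    qed
    finally show ?thesis .
  qed
  have "?I < \<infinity>"
    using Q by (meson INF_lower order.strict_trans1)
  moreover have "ennreal (c powr p * m) \<le> ?I"
    by (intro INF_greatest le)
  ultimately have "c powr p * m \<le> enn2real ?I"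
    by (metis enn2real_ennreal enn2real_mono infinity_ennreal_def m(1) mult_nonneg_nonneg powr_ge_zero)
  then have "(c powr p * m) powr (1 / p) \<le> wasserstein_dist M d p \<mu> \<nu>"
    unfolding wasserstein_dist_def using m p by (intro powr_mono2) auto
  moreover have "(c powr p * m) powr (1 / p) = c * m powr (1 / p)"
    using c m p by (simp add: powr_mult powr_powr)
  ultimately show ?thesis by simp
qed

section \<open>Countable spaces and the mass distribution principle\<close>

text \<open>A cover by singletons costs nothing, as \<open>0 powr s = 0\<close>. Enumerating
  \<open>X\<close> by \<open>from_nat_into\<close> presupposes a point, so the empty space is
  covered by empty sets instead.\<close>

lemma hausdorff_dim_countable:
  assumes "countable X" "\<And>x. x \<in> X \<Longrightarrow> d x x = 0"
  shows "hausdorff_dim X d = 0"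
proof -
  have "gauge_premeasure (\<lambda>r. r powr s) X d \<delta> = 0" for s \<delta>
  proof (cases "X = {}")
    case True
    have "(\<lambda>_. {}) \<in> delta_covers X d \<delta>"
      by (simp add: True delta_covers_def ediam_def bot_ennreal)
    then have "gauge_premeasure (\<lambda>r. r powr s) X d \<delta>
        \<le> (\<Sum>i::nat. ennreal (enn2real (ediam d {}) powr s))"
      unfolding gauge_premeasure_def by (rule INF_lower)
    then show ?thesis by (simp add: ediam_def bot_ennreal)
  next
    case False
    let ?E = "\<lambda>i. {from_nat_into X i}"
    have 0: "ediam d (?E i) = 0" for i
      using False assms by (simp add: ediam_def from_nat_into)
    have "?E \<in> delta_covers X d \<delta>"
      using False assms(1) 0 by (auto simp: delta_covers_def from_nat_into)
        (metis from_nat_into_surj)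
    then have "gauge_premeasure (\<lambda>r. r powr s) X d \<delta>
        \<le> (\<Sum>i. ennreal (enn2real (ediam d (?E i)) powr s))"
      unfolding gauge_premeasure_def by (rule INF_lower)
    then show ?thesis by (simp add: 0)
  qed
  then show ?thesis
    by (simp add: hausdorff_dim_def critical_parameter_def gauge_measure_eq_SUP bot_ennreal)
qed

text \<open>
  The mass distribution principle for the law of \<open>\<phi>\<close>. As \<open>\<phi>\<close> need not be measurable and the
  covering sets are arbitrary, their preimages are replaced by measurable supersets.
\<close>

lemma premeasure_ge_of_random_point:
  fixes \<phi> :: "'b \<Rightarrow> 'a"
  assumes "prob_space P" and \<phi>: "\<And>\<omega>. \<omega> \<in> space P \<Longrightarrow> \<phi> \<omega> \<in> Z"
    and small: "\<And>E. E \<subseteq> Z \<Longrightarrow> ediam d E \<le> ennreal \<delta> \<Longrightarrow>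
      \<exists>A\<in>sets P. {\<omega>\<in>space P. \<phi> \<omega> \<in> E} \<subseteq> A \<and> emeasure P A \<le> ennreal (f (enn2real (ediam d E)))"
  shows "1 \<le> gauge_premeasure f Z d \<delta>"
  unfolding gauge_premeasure_def
proof (rule INF_greatest)
  interpret prob_space P by fact
  fix E assume "E \<in> delta_covers Z d \<delta>"
  then have E: "\<And>i. E i \<subseteq> Z" "\<And>i. ediam d (E i) \<le> ennreal \<delta>" "Z \<subseteq> (\<Union>i. E i)"
    by (auto simp: delta_covers_def)
  obtain A where A: "\<And>i. A i \<in> sets P" "\<And>i. {\<omega>\<in>space P. \<phi> \<omega> \<in> E i} \<subseteq> A i"
      "\<And>i. emeasure P (A i) \<le> ennreal (f (enn2real (ediam d (E i))))"
    using small[OF E(1,2)] by metis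
  have "1 = emeasure P (space P)" by (simp add: emeasure_space_1)
  also have "\<dots> \<le> emeasure P (\<Union>i. A i)"
  proof (rule emeasure_mono)
    show "space P \<subseteq> (\<Union>i. A i)"
    proof
      fix \<omega> assume \<omega>: "\<omega> \<in> space P"
      with \<phi> E(3) obtain i where "\<phi> \<omega> \<in> E i" by blast
      with \<omega> A(2) show "\<omega> \<in> (\<Union>i. A i)" by blast
    qed
  qed (use A(1) in auto)
  also have "\<dots> \<le> (\<Sum>i. emeasure P (A i))"
    using A(1) by (intro emeasure_subadditive_countably) auto
  also have "\<dots> \<le> (\<Sum>i. ennreal (f (enn2real (ediam d (E i)))))"
    using A(3) by (intro suminf_le) auto
  finally show "1 \<le> (\<Sum>i. ennreal (f (enn2real (ediam d (E i)))))" .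
qed

section \<open>The max ultrametric and its compact carriers\<close>

definition max_dist :: "real \<Rightarrow> real \<Rightarrow> real" where
  "max_dist x y = (if x = y then 0 else max \<bar>x\<bar> \<bar>y\<bar>)"

lemma Ultrametric_space_max_dist: "Ultrametric_space X max_dist"
  by standard (auto simp: max_dist_def le_max_iff_disj)

text \<open>The ball of radius \<open>e\<close> around \<open>0\<close> contains every point with
  absolute value below \<open>e\<close>. So the member of an open cover that contains
  \<open>0\<close> misses only finitely many points.\<close>

lemma compact_space_max_dist:
  assumes X: "0 \<in> X" and fin: "\<And>e. e > 0 \<Longrightarrow> finite {x\<in>X. e \<le> \<bar>x\<bar>}"
  shows "compact_space (Metric_space.mtopology X max_dist)"
proof -
  interpret Ultrametric_space X max_dist by (rule Ultrametric_space_max_dist)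
  show ?thesis unfolding compact_space_alt
  proof (intro allI impI)
    fix \<U> assume \<U>: "Ball \<U> (openin mtopology) \<and> topspace mtopology \<subseteq> \<Union> \<U>"
    then obtain U where U: "U \<in> \<U>" "0 \<in> U" using X by auto
    then obtain e where e: "e > 0" "mball 0 e \<subseteq> U"
      using \<U> by (meson openin_mtopology)
    have "\<forall>x\<in>{x\<in>X. e \<le> \<bar>x\<bar>}. \<exists>V\<in>\<U>. x \<in> V" using \<U> by auto
    then obtain V where V: "\<And>x. x \<in> X \<Longrightarrow> e \<le> \<bar>x\<bar> \<Longrightarrow> V x \<in> \<U> \<and> x \<in> V x" by (metis mem_Collect_eq)
    have "x \<in> U" if "x \<in> X" "\<bar>x\<bar> < e" for x
      using e that X by (force simp: max_dist_def subset_iff)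
    then have "X \<subseteq> \<Union> (insert U (V ` {x\<in>X. e \<le> \<bar>x\<bar>}))"
      using V by fastforce
    then show "\<exists>\<F>. finite \<F> \<and> \<F> \<subseteq> \<U> \<and> topspace mtopology \<subseteq> \<Union> \<F>"
      using fin[OF e(1)] U V by (intro exI[of _ "insert U (V ` {x\<in>X. e \<le> \<bar>x\<bar>})"]) auto
  qed
qed

section \<open>The block space\<close>

text \<open>The exponent is chosen because \<open>4 ^ ((k + 2) * k)\<close> is
  \<open>1 / r ^ k\<close> at \<open>r = (1/4) ^ (k + 2)\<close>. Thus
  \<open>1 / block_size k\<close> is at most the gauge of exponent \<open>k\<close> at this
  scale.\<close>

definition block_size :: "nat \<Rightarrow> nat" where
  "block_size k = nat \<lceil>exp (4 ^ ((k + 2) * k) :: real)\<rceil>"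

text \<open>
  The reciprocal of a point of block \<open>k\<close> lies strictly between \<open>k + 1\<close> and \<open>k + 2\<close>, so blocks are disjoint.
\<close>

definition block_point :: "nat \<Rightarrow> nat \<Rightarrow> real" where
  "block_point k j = 1 / (k + 1 + 1 / (j + 2))"

definition block_space :: "real set" where
  "block_space = insert 0 (\<Union>k. block_point k ` {..<block_size k})"

lemma block_size_ge: "exp (4 ^ ((k + 2) * k)) \<le> real (block_size k)"
  unfolding block_size_def by (rule real_nat_ceiling_ge)

lemma block_size_pos [simp]: "0 < block_size k"
  using block_size_ge[of k] by (metis exp_gt_zero less_le_trans of_nat_0_less_iff)

lemma block_point_eq_iff [simp]: "block_point k i = block_point l j \<longleftrightarrow> k = l \<and> i = j"
proof
  assume "block_point k i = block_point l j"
  then have *: "real k + 1 + 1 / (real i + 2) = real l + 1 + 1 / (real j + 2)"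
    unfolding block_point_def by simp
  have "1 / (real n + 2) < 1" "1 / (real n + 2) > 0" for n by simp_all
  from this[of i] this[of j] * have "real k < real l + 1" "real l < real k + 1" by linarith+
  then have "k = l" by linarith
  with * show "k = l \<and> i = j" by simp
qed simp

lemma block_point_ge: "1 / (real k + 2) \<le> block_point k j"
  unfolding block_point_def by (intro frac_le) (auto simp: add_pos_pos)

lemma block_point_pos: "0 < block_point k j"
  using block_point_ge[of k j] by (rule less_le_trans[rotated]) simp

lemma block_point_le: "block_point k j \<le> 1 / (real k + 1)"
  unfolding block_point_def by (simp add: frac_le)

lemma block_space_subset: "block_space \<subseteq> {0..1}"
proof -
  have "block_point k j \<le> 1" for k j
    by (rule order_trans[OF block_point_le]) simp
  then show ?thesis
    by (auto simp: block_space_def block_point_pos less_imp_le)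
qed

lemma finite_block_space_ge:
  assumes "e > 0" shows "finite {x\<in>block_space. e \<le> \<bar>x\<bar>}"
proof -
  obtain n where n: "1 / e < real n" using reals_Archimedean2 by blast
  have "k < n" if "e \<le> block_point k j" for k j
  proof -
    from that block_point_le[of k j] have "e \<le> 1 / (real k + 1)" by linarith
    then have "real k + 1 \<le> 1 / e" using assms by (simp add: field_simps)
    with n show ?thesis by linarith
  qed
  then have "{x\<in>block_space. e \<le> \<bar>x\<bar>} \<subseteq> (\<Union>k<n. block_point k ` {..<block_size k})"
    using assms by (fastforce simp: block_space_def abs_of_pos[OF block_point_pos])
  then show ?thesis by (rule finite_subset) auto
qed

lemma countable_block_space: "countable block_space"
  unfolding block_space_def by auto

interpretation block: Ultrametric_space block_space max_dist
  by (rule Ultrametric_space_max_dist)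

section \<open>Measures attached to selections\<close>

definition block_measure :: "(nat \<Rightarrow> nat) \<Rightarrow> real measure" where
  "block_measure \<omega> = geometric_mixture block.mtopology (\<lambda>k. block_point k (\<omega> k))"

lemma block_point_in_block_space: "j < block_size k \<Longrightarrow> block_point k j \<in> block_space"
  by (auto simp: block_space_def)

lemma block_measure_in_borel_probs:
  assumes "\<And>k. \<omega> k < block_size k"
  shows "block_measure \<omega> \<in> borel_probs block.mtopology"
  unfolding block_measure_def using assms
  by (intro geometric_mixture_in_borel_probs) (auto simp: block_point_in_block_space)

lemma emeasure_block_measure:
  assumes "\<And>k. \<omega> k < block_size k" "j < block_size k"
  shows "emeasure (block_measure \<omega>) {block_point k j} = (if \<omega> k = j then ennreal ((1/2) ^ Suc k) else 0)"
proof -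
  have "{block_point k j} \<in> sets (borel_of block.mtopology)"
    using assms(2) by (intro closedin_sets_borel_of closedin_Hausdorff_singleton)
      (auto simp: block.Hausdorff_space_mtopology block_point_in_block_space)
  moreover have "(\<lambda>l. block_point l (\<omega> l)) -` {block_point k j} = (if \<omega> k = j then {k} else {})"
    by auto
  ultimately show ?thesis
    unfolding block_measure_def using assms(1)
    by (subst emeasure_geometric_mixture)
      (auto simp: block_point_in_block_space emeasure_pmf_single)
qed

text \<open>The selected point of block \<open>k\<close> carries mass \<open>(1/2) ^ Suc k\<close>
  under the first measure and none under the second. This mass travels at least
  \<open>1 / (k + 2)\<close>, which is at least \<open>(1/2) ^ Suc k\<close>. Since
  \<open>1 / p\<close> is at most 1, the root does not decrease the mass, and the bound is uniform
  in \<open>p\<close>.\<close>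

lemma wasserstein_block_measure_ge:
  assumes \<omega>: "\<And>k. \<omega> k < block_size k" "\<And>k. \<omega>' k < block_size k"
    and k: "\<omega> k \<noteq> \<omega>' k" and p: "1 \<le> p"
  shows "(1/4) ^ Suc k
    \<le> wasserstein_dist block_space max_dist p (block_measure \<omega>) (block_measure \<omega>')"
proof -
  let ?x = "block_point k (\<omega> k)"
  let ?Q = "geometric_mixture (prod_topology block.mtopology block.mtopology)
    (\<lambda>k. (block_point k (\<omega> k), block_point k (\<omega>' k)))"
  have Q: "?Q \<in> couplings block.mtopology (block_measure \<omega>) (block_measure \<omega>')"
    unfolding block_measure_def using \<omega>
    by (intro geometric_mixture_coupling) (auto simp: block_point_in_block_space)
  then have "?Q \<in> borel_probs (prod_topology block.mtopology block.mtopology)"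
    by (simp add: couplings_def)
  then interpret Q: prob_space ?Q by (simp add: borel_probs_def)
  have spaceQ: "space ?Q = block_space \<times> block_space"
    by (simp add: geometric_mixture_def)
  \<comment> \<open>All distances in \<open>block_space\<close> are at most 1, so any coupling has
    finite cost.\<close>
  have "(\<integral>\<^sup>+ (a, b). ennreal (max_dist a b powr p) \<partial>?Q) \<le> (\<integral>\<^sup>+ z. 1 \<partial>?Q)"
  proof (rule nn_integral_mono)
    fix z assume "z \<in> space ?Q"
    then obtain a b where z: "z = (a, b)" "a \<in> block_space" "b \<in> block_space"
      unfolding spaceQ by auto
    with block_space_subset have "max_dist a b \<le> 1" by (auto simp: max_dist_def)
    then have "max_dist a b powr p \<le> 1"
      using p by (intro powr_le1) (auto intro: block.nonneg)
    then show "(case z of (a, b) \<Rightarrow> ennreal (max_dist a b powr p)) \<le> 1"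
      using z by simp
  qed
  then have "(\<integral>\<^sup>+ (a, b). ennreal (max_dist a b powr p) \<partial>?Q) < \<infinity>"
    by (simp add: Q.emeasure_space_1 order_le_less_trans)
  \<comment> \<open>Here \<open>c\<close> is \<open>?x\<close> itself: \<open>max_dist\<close> puts
    every other point at distance at least \<open>?x\<close>.\<close>
  then have W: "?x * ((1/2) ^ Suc k) powr (1 / p)
      \<le> wasserstein_dist block_space max_dist p (block_measure \<omega>) (block_measure \<omega>')"
  proof (rule block.wasserstein_dist_ge[OF Q, of p ?x])
    show "emeasure (block_measure \<omega>') {?x} = 0"
      using emeasure_block_measure[OF \<omega>(2) \<omega>(1)] k by auto
    show "ennreal ((1/2) ^ Suc k) \<le> emeasure (block_measure \<omega>) {?x}"
      using emeasure_block_measure[OF \<omega>(1) \<omega>(1), of k] by simp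
  qed (use \<omega> p block_point_pos[of k "\<omega> k"] in \<open>auto simp: block_point_in_block_space max_dist_def\<close>)
  have "k + 2 \<le> 2 ^ Suc k" by (induction k) auto
  then have "real (k + 2) \<le> 2 ^ Suc k" by (metis of_nat_le_iff of_nat_numeral of_nat_power)
  then have "(1/2) ^ Suc k \<le> 1 / (real k + 2)"
    by (simp add: power_divide field_simps)
  also note block_point_ge[of k "\<omega> k"]
  finally have 1: "(1/2) ^ Suc k \<le> ?x" .
  have "((1/2) ^ Suc k) powr 1 \<le> ((1/2) ^ Suc k :: real) powr (1 / p)"
    using p by (intro powr_mono') (auto simp: power_le_one simp del: power_Suc)
  then have 2: "(1/2) ^ Suc k \<le> ((1/2) ^ Suc k :: real) powr (1 / p)"
    by (simp del: power_Suc)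
  have "(1/4 :: real) ^ Suc k = (1/2) ^ Suc k * (1/2) ^ Suc k"
    by (simp add: power_mult_distrib[symmetric] del: power_Suc)
  also have "\<dots> \<le> ?x * ((1/2) ^ Suc k) powr (1 / p)"
    using 1 2 block_point_pos[of k "\<omega> k"] by (intro mult_mono) (auto simp del: power_Suc)
  finally show ?thesis using W by linarith
qed

section \<open>Uniform random selections\<close>

definition block_choice :: "(nat \<Rightarrow> nat) measure" where
  "block_choice = PiM UNIV (\<lambda>k. uniform_count_measure {..<block_size k})"

lemma prob_space_block_choice: "prob_space block_choice"
  unfolding block_choice_def
  by (intro prob_space_PiM prob_space_uniform_count_measure) (auto simp: lessThan_empty_iff)

lemma space_block_choice: "space block_choice = {\<omega>. \<forall>k. \<omega> k < block_size k}"
  by (auto simp: block_choice_def space_PiM PiE_UNIV_domain space_uniform_count_measure)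

text \<open>The cylinder is the preimage of \<open>{j}\<close> under a coordinate, whose law is the
  uniform factor.\<close>

lemma block_choice_cylinder:
  assumes "j < block_size k"
  shows "{\<omega>\<in>space block_choice. \<omega> k = j} \<in> sets block_choice"
    and "emeasure block_choice {\<omega>\<in>space block_choice. \<omega> k = j} = ennreal (1 / block_size k)"
proof -
  let ?M = "\<lambda>k. uniform_count_measure {..<block_size k}"
  interpret product_prob_space ?M UNIV
    by (intro product_prob_spaceI prob_space_uniform_count_measure) (auto simp: lessThan_empty_iff)
  have eq: "{\<omega>\<in>space block_choice. \<omega> k = j} = (\<lambda>\<omega>. \<omega> k) -` {j} \<inter> space (PiM UNIV ?M)"
    by (auto simp: block_choice_def)
  have j: "{j} \<in> sets (?M k)" using assms by (simp add: sets_uniform_count_measure)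
  have "(\<lambda>\<omega>. \<omega> k) \<in> PiM UNIV ?M \<rightarrow>\<^sub>M ?M k" by (rule measurable_component_singleton) simp
  from measurable_sets[OF this j] show "{\<omega>\<in>space block_choice. \<omega> k = j} \<in> sets block_choice"
    unfolding eq by (simp add: block_choice_def)
  have "emeasure (?M k) {j} = emeasure (distr (PiM UNIV ?M) (?M k) (\<lambda>\<omega>. \<omega> k)) {j}"
    by (simp add: PiM_component)
  also have "\<dots> = emeasure (PiM UNIV ?M) ((\<lambda>\<omega>. \<omega> k) -` {j} \<inter> space (PiM UNIV ?M))"
    using j by (intro emeasure_distr measurable_component_singleton) auto
  finally show "emeasure block_choice {\<omega>\<in>space block_choice. \<omega> k = j} = ennreal (1 / block_size k)"
    unfolding eq using assms by (simp add: block_choice_def emeasure_uniform_count_measure)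
qed

section \<open>Comparison with the gauges and the critical parameter\<close>

text \<open>The scale is one step finer than the separation \<open>(1/4) ^ Suc k\<close> of
  selections differing at \<open>k\<close>: a set too small for level \<open>k\<close> but not for
  level \<open>k + 1\<close> has diameter at least \<open>(1/4) ^ Suc (Suc k)\<close>.\<close>

lemma inverse_block_size_le_gauge:
  assumes "(1/4) ^ Suc (Suc k) \<le> r" "n \<le> k"
  shows "1 / real (block_size k) \<le> pow_exp_gauge (real n) r"
proof -
  have "0 < (1/4 :: real) ^ Suc (Suc k)" by simp
  with assms have r: "0 < r" by linarith
  have "(1/4) ^ ((k + 2) * n) = ((1/4 :: real) ^ Suc (Suc k)) ^ n"
    by (simp add: power_mult[symmetric] del: power_Suc)
  also have "\<dots> \<le> r ^ n" using assms by (intro power_mono) auto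
  finally have "1 / r ^ n \<le> 4 ^ ((k + 2) * n)"
    using r by (simp add: power_divide field_simps)
  also have "\<dots> \<le> 4 ^ ((k + 2) * k)"
    using assms by (intro power_increasing mult_left_mono) auto
  finally have "exp (- (4 ^ ((k + 2) * k))) \<le> exp (- (1 / r ^ n))" by simp
  moreover have "1 / real (block_size k) \<le> 1 / exp (4 ^ ((k + 2) * k))"
    using block_size_ge[of k] by (intro divide_left_mono) auto
  ultimately show ?thesis
    using r by (simp add: pow_exp_gauge_def powr_realpow exp_minus inverse_eq_divide)
qed

text \<open>This handles covering sets of diameter 0, where the gauge is 0 and no single cylinder is
  small enough.\<close>

lemma one_div_block_size_tendsto: "(\<lambda>k. 1 / real (block_size k)) \<longlonglongrightarrow> 0"
proof (rule tendsto_sandwich[OF _ _ tendsto_const])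
  show "\<forall>\<^sub>F k in sequentially. 0 \<le> 1 / real (block_size k)" by simp
  show "\<forall>\<^sub>F k in sequentially. 1 / real (block_size k) \<le> 1 / real k"
  proof (rule eventually_sequentiallyI[of 1])
    fix k :: nat assume "1 \<le> k"
    have "k < 4 ^ k" by (rule power_gt_expt) simp
    then have "real k \<le> 4 ^ k" by simp
    also have "\<dots> \<le> 4 ^ ((k + 2) * k)" by (intro power_increasing) auto
    also have "\<dots> \<le> exp (4 ^ ((k + 2) * k))" using exp_ge_add_one_self[of "4 ^ ((k + 2) * k)"] by linarith
    also note block_size_ge
    finally show "1 / real (block_size k) \<le> 1 / real k"
      using \<open>1 \<le> k\<close> by (intro divide_left_mono) auto
  qed
  show "(\<lambda>k. 1 / real k) \<longlonglongrightarrow> 0" by (rule lim_1_over_n)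
qed

text \<open>Natural exponents suffice, being unbounded. The same random selection serves every
  exponent and every \<open>p\<close>; only the scale \<open>\<delta>\<close> depends on the
  exponent.\<close>

lemma crit_P_block_space:
  assumes p: "1 \<le> p"
  shows "crit_P (borel_probs block.mtopology) (wasserstein_dist block_space max_dist p) = \<infinity>"
proof -
  let ?Z = "borel_probs block.mtopology" and ?W = "wasserstein_dist block_space max_dist p"
  have "0 < gauge_measure (pow_exp_gauge (real n)) ?Z ?W" for n
  proof -
    \<comment> \<open>Halving gives \<open>r < (1/4) ^ Suc n\<close> strictly, which forces
      \<open>n < l\<close> below and hence \<open>n \<le> k\<close> for
      \<open>k = l - 1\<close>.\<close>
    define \<delta> :: real where "\<delta> = (1/4) ^ Suc n / 2"
    have "\<delta> > 0" by (simp add: \<delta>_def)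
    have "1 \<le> gauge_premeasure (pow_exp_gauge (real n)) ?Z ?W \<delta>"
    proof (rule premeasure_ge_of_random_point[where \<phi> = block_measure, OF prob_space_block_choice])
      show "block_measure \<omega> \<in> ?Z" if "\<omega> \<in> space block_choice" for \<omega>
        using that by (intro block_measure_in_borel_probs) (simp add: space_block_choice)
      fix E assume E: "E \<subseteq> ?Z" "ediam ?W E \<le> ennreal \<delta>"
      define r where "r = enn2real (ediam ?W E)"
      have diam: "ediam ?W E = ennreal r"
        using E(2) unfolding r_def
        by (metis ennreal_enn2real ennreal_less_top order_le_less_trans)
      have r: "0 \<le> r" "r \<le> \<delta>"
        using E(2) \<open>\<delta> > 0\<close> unfolding diam by (auto simp: r_def)
      show "\<exists>A\<in>sets block_choice. {\<omega> \<in> space block_choice. block_measure \<omega> \<in> E} \<subseteq> A \<and>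
          emeasure block_choice A \<le> ennreal (pow_exp_gauge (real n) (enn2real (ediam ?W E)))"
      proof (cases "{\<omega> \<in> space block_choice. block_measure \<omega> \<in> E} = {}")
        case True
        then show ?thesis by (intro bexI[of _ "{}"]) auto
      next
        case False
        then obtain \<tau> where \<tau>: "\<And>k. \<tau> k < block_size k" "block_measure \<tau> \<in> E"
          by (auto simp: space_block_choice)
        \<comment> \<open>The cylinders through the reference selection \<open>\<tau>\<close> serve
          as the measurable supersets.\<close>
        define C where "C k = {\<omega> \<in> space block_choice. \<omega> k = \<tau> k}" for k
        have C: "C k \<in> sets block_choice" "emeasure block_choice (C k) = ennreal (1 / block_size k)" for k
          unfolding C_def using block_choice_cylinder \<tau>(1) by auto
        have sub: "{\<omega> \<in> space block_choice. block_measure \<omega> \<in> E} \<subseteq> C k" if "r < (1/4) ^ Suc k" for k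
        proof
          fix \<omega> assume \<omega>: "\<omega> \<in> {\<omega> \<in> space block_choice. block_measure \<omega> \<in> E}"
          have "ennreal (?W (block_measure \<omega>) (block_measure \<tau>)) \<le> ediam ?W E"
            unfolding ediam_def using \<omega> \<tau> by (intro SUP_upper2[of "(block_measure \<omega>, block_measure \<tau>)"]) auto
          then have "?W (block_measure \<omega>) (block_measure \<tau>) \<le> r"
            unfolding diam using r by (simp add: ennreal_le_iff)
          with that have "?W (block_measure \<omega>) (block_measure \<tau>) < (1/4) ^ Suc k" by linarith
          then have "\<omega> k = \<tau> k"
            using wasserstein_block_measure_ge[of \<omega> \<tau> k p] \<omega> \<tau> p
            by (force simp: space_block_choice simp del: power_Suc)
          then show "\<omega> \<in> C k" using \<omega> by (simp add: C_def)
        qed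
        show ?thesis
        proof (cases "r = 0")
          case True
          \<comment> \<open>The gauge vanishes, so all cylinders are needed at once.\<close>
          have "emeasure block_choice (\<Inter>k. C k) \<le> ennreal (1 / block_size k)" for k
            unfolding C(2)[symmetric] using C(1) by (intro emeasure_mono) auto
          moreover have "(\<lambda>k. ennreal (1 / block_size k)) \<longlonglongrightarrow> ennreal 0"
            by (intro tendsto_ennrealI one_div_block_size_tendsto)
          ultimately have "emeasure block_choice (\<Inter>k. C k) \<le> ennreal 0"
            by (intro tendsto_lowerbound[of _ _ sequentially]) auto
          then show ?thesis
            using sub C(1) True by (intro bexI[of _ "\<Inter>k. C k"]) auto
        next
          case False
          have "\<exists>k. (1/4) ^ Suc k \<le> r"
          proof -
            obtain k where "(1/4 :: real) ^ k < r"
              using real_arch_pow_inv[of r "1/4"] r False by auto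
            moreover have "(1/4 :: real) ^ Suc k \<le> (1/4) ^ k" by simp
            ultimately show ?thesis by (intro exI[of _ k]) linarith
          qed
          \<comment> \<open>At \<open>k = l - 1\<close> both bounds hold:
            \<open>r < (1/4) ^ Suc k\<close>, so \<open>C k\<close> contains the preimage of
            \<open>E\<close>, and \<open>(1/4) ^ Suc (Suc k) \<le> r\<close>, so the gauge dominates
            \<open>1 / block_size k\<close>.\<close>
          define l where "l = (LEAST k. (1/4) ^ Suc k \<le> r)"
          have l: "(1/4) ^ Suc l \<le> r"
            unfolding l_def using \<open>\<exists>k. _\<close> by (rule LeastI_ex)
          have less: "r < (1/4) ^ Suc k" if "k < l" for k
            using not_less_Least[of k "\<lambda>k. (1/4) ^ Suc k \<le> r"] that unfolding l_def by linarith
          have "n < l"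
          proof (rule ccontr)
            assume "\<not> n < l"
            then have "(1/4 :: real) ^ Suc n \<le> (1/4) ^ Suc l" by (intro power_decreasing) auto
            moreover have "0 < (1/4 :: real) ^ Suc n" by simp
            ultimately show False using l r unfolding \<delta>_def by linarith
          qed
          then obtain k where k: "l = Suc k" "n \<le> k" by (cases l) auto
          have "emeasure block_choice (C k) \<le> ennreal (pow_exp_gauge (real n) r)"
            unfolding C(2) using l k by (intro ennreal_leI inverse_block_size_le_gauge) auto
          then show ?thesis
            using sub[OF less] k C(1) unfolding r_def by (intro bexI[of _ "C k"]) auto
        qed
      qed
    qed
    also have "\<dots> \<le> gauge_measure (pow_exp_gauge (real n)) ?Z ?W"
      unfolding gauge_measure_eq_SUP using \<open>\<delta> > 0\<close> by (intro SUP_upper) auto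
    finally show ?thesis by (simp add: less_le_trans[OF zero_less_one])
  qed
  \<comment> \<open>The shift to \<open>Suc n\<close> is made because
    \<open>critical_parameter\<close> ranges over \<open>s > 0\<close> only.\<close>
  then have "0 < gauge_measure (pow_exp_gauge (real (Suc n))) ?Z ?W" for n by blast
  then have *: "ennreal (real (Suc n)) \<le> crit_P ?Z ?W" for n
    unfolding crit_P_def critical_parameter_def
    by (intro Sup_upper CollectI exI[of _ "real (Suc n)"]) auto
  have "\<not> crit_P ?Z ?W < top"
  proof
    assume "crit_P ?Z ?W < top"
    then obtain n where n: "crit_P ?Z ?W < of_nat n" using ennreal_Ex_less_of_nat by blast
    also have "of_nat n \<le> (of_nat (Suc n) :: ennreal)" by (rule of_nat_mono) simp
    also have "\<dots> \<le> crit_P ?Z ?W" using *[of n] by (simp only: ennreal_of_nat_eq_real_of_nat)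
    finally show False by simp
  qed
  then show ?thesis by (simp flip: less_top)
qed

theorem proposition1p7:
  "\<exists>(X :: real set) d.
     Ultrametric_space X d \<and>
     compact_space (Metric_space.mtopology X d) \<and>
     countable X \<and>
     hausdorff_dim X d = 0 \<and>
     (\<forall>p::real. 1 \<le> p \<longrightarrow>
        crit_P (borel_probs (Metric_space.mtopology X d)) (wasserstein_dist X d p) = \<infinity>)"
proof (intro exI conjI allI impI)
  show "Ultrametric_space block_space max_dist" by unfold_locales
  show "compact_space block.mtopology"
    using finite_block_space_ge by (intro compact_space_max_dist) (simp_all add: block_space_def)
  show "hausdorff_dim block_space max_dist = 0"
    by (rule hausdorff_dim_countable[OF countable_block_space]) (simp add: max_dist_def)
qed (rule countable_block_space, rule crit_P_block_space)

end
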